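(* Let $p$ be a prime, and let $k$ be an integer with $2\le k\le \sqrt{p/(2\log p+1)}-1$. If $A$ is any valid multiset contained in $\mathbb{Z}_p^2$ with $|A| = p+k$, then $\#\Sigma A \ge (k+2)p$.
   Context: $\log$ is the natural logarithm. $\mathbb{Z}_p$ is the cyclic group of order $p$, and $\mathbb{Z}_p^2=\mathbb{Z}_p\oplus\mathbb{Z}_p$ with identity $\mathbf 0=(0,0)$. Multisets are finite. For a multiset $S$, $|S|$ is the total number of elements of $S$ counted with multiplicity, and $\#S$ is the number of distinct elements of $S$. If $A$ is a multiset in an abelian group $G$ in which $x$ occurs with multiplicity $m_x$, its sumset is the set $\Sigma A=\{\sum_{x\in G}\delta_x x : 0\le\delta_x\le m_x,\ \delta_x\in\mathbb{Z}\}$ of all sums of submultisets of $A$ (including the empty sum). A multiset $A$ contained in $\mathbb{Z}_p^2$ is called valid if $\mathbf 0\notin A$ and every subgroup of $\mathbb{Z}_p^2$ of order $p$ contains fewer than $p$ points of $A$, counting multiplicity. *)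

theory Defs
  imports
    Complex_Main
    "HOL-Library.Multiset"
    "HOL-Library.Product_Plus"
    "Berlekamp_Zassenhaus.Finite_Field"
begin

text \<open>
  The group $\mathbb{Z}_p \oplus \mathbb{Z}_p$ is the type \<open>'p zp2\<close>, where the index type \<open>'p\<close> has
  exactly \<open>p\<close> elements; \<open>'p :: prime_card\<close> says that \<open>p = CARD('p)\<close> is prime.
  Its addition is componentwise and its zero is \<open>(0, 0)\<close>.
\<close>

type_synonym 'p zp2 = "'p mod_ring \<times> 'p mod_ring"

definition add_subgroup :: "'a :: ab_group_add set \<Rightarrow> bool" where
  "add_subgroup H \<longleftrightarrow> 0 \<in> H \<and> (\<forall>x\<in>H. \<forall>y\<in>H. x + y \<in> H) \<and> (\<forall>x\<in>H. - x \<in> H)"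

definition sumset :: "'a :: ab_group_add multiset \<Rightarrow> 'a set" where
  "sumset A = {\<Sum>\<^sub># B | B. B \<subseteq># A}"

definition valid :: "'p :: prime_card zp2 multiset \<Rightarrow> bool" where
  "valid A \<longleftrightarrow> 0 \<notin># A \<and>
     (\<forall>H. add_subgroup H \<and> card H = CARD('p) \<longrightarrow> size {#x \<in># A. x \<in> H#} < CARD('p))"

end

theory Submission
  imports Defs
begin

text \<open>
  Fix a line, that is, a subgroup of order \<open>p\<close>, that contains \<open>h\<close> elements of \<open>A\<close>. The sums of
  these elements form at least \<open>h + 1\<close> points of the line (note that \<open>h \<le> p - 1\<close> by validity), and
  the sums of the other \<open>p + k - h\<close> elements meet at least \<open>min p (p + k - h + 1)\<close> of its cosets;
  both bounds are the Cauchy-Davenport theorem for summands \<open>{0, b}\<close>. Hence \<open>A\<close> has at least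
  \<open>(h + 1) * min p (p + k - h + 1)\<close> sums (lemma \<open>card_sumset_via_line\<close>). For \<open>k < h < p\<close> the
  minimum is its second argument, and
  \<open>(h + 1) * (p + k - h + 1) - (k + 2) * p = (h - k - 1) * (p - 1 - h)\<close>
  is nonnegative. So one line with more than \<open>k\<close> elements of \<open>A\<close> is enough.

  Suppose now that every line contains at most \<open>k\<close> elements of \<open>A\<close>. Then the sums can be grown
  greedily. Let \<open>S\<close> be the set of sums of the elements used so far. While more than \<open>k\<close> elements
  are left, two of them, \<open>x\<close> and \<open>y\<close>, are linearly independent. A point is determined by its
  coset modulo \<open>x\<close> together with its coset modulo \<open>y\<close>, so in one of the two directions, \<open>z\<close> say,
  \<open>S\<close> meets at least \<open>sqrt (card S)\<close> cosets. Each of these cosets that does not lie inside \<open>S\<close>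
  gives a new point of \<open>z + S\<close>, and only \<open>card S / p\<close> cosets can lie inside \<open>S\<close>, which is
  negligible while \<open>card S\<close> is small compared with \<open>p ^ 2\<close>. Thus \<open>card S\<close> grows
  quadratically in the number of steps (lemmas \<open>sqrt_growth_step\<close> and \<open>quadratic_growth\<close>). There
  are \<open>p\<close> steps, so a constant multiple of \<open>p ^ 2\<close> is reached unless \<open>(k + 2) * p\<close> is exceeded
  earlier; the upper bound on \<open>k\<close> ensures that this multiple is at least \<open>(k + 2) * p\<close>.
\<close>

section \<open>Subset sums and translations\<close>

lemma zero_in_sumset: "0 \<in> sumset B"
  unfolding sumset_def by (intro CollectI exI[of _ "{#}"]) simp

lemma sumset_mono: "B \<subseteq># A \<Longrightarrow> sumset B \<subseteq> sumset A"
  unfolding sumset_def by (auto intro: subset_mset.order_trans)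

lemma sumset_union: "s \<in> sumset B \<Longrightarrow> t \<in> sumset C \<Longrightarrow> s + t \<in> sumset (B + C)"
  unfolding sumset_def
  by (smt (verit, best) mem_Collect_eq subset_mset.add_mono sum_mset.union)

lemma sumset_image_additive:
  assumes "\<And>u v. f (u + v) = f u + f v" "f 0 = 0"
  shows "sumset (image_mset f B) \<subseteq> f ` sumset B"
proof
  fix s assume "s \<in> sumset (image_mset f B)"
  then obtain C where C: "C \<subseteq># image_mset f B" "s = \<Sum>\<^sub># C"
    by (auto simp: sumset_def)
  obtain D where D: "D \<subseteq># B" "C = image_mset f D"
    using C(1) by (auto simp: mset_subset_eq_exists_conv dest!: image_mset_eq_plusD)
  have "\<Sum>\<^sub># (image_mset f D) = f (\<Sum>\<^sub># D)"
    by (induction D) (simp_all add: assms)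
  then show "s \<in> f ` sumset B"
    using C D by (auto simp: sumset_def)
qed

lemma sumset_add_mset: "sumset B \<union> (+) b ` sumset B \<subseteq> sumset (add_mset b B)"
proof -
  have "sumset B \<subseteq> sumset (add_mset b B)"
    by (intro sumset_mono) simp
  moreover have "b + s \<in> sumset (add_mset b B)" if s: "s \<in> sumset B" for s
  proof -
    obtain C where "C \<subseteq># B" "s = \<Sum>\<^sub># C"
      using s by (auto simp: sumset_def)
    then show ?thesis
      unfolding sumset_def by (intro CollectI exI[of _ "add_mset b C"]) simp
  qed
  ultimately show ?thesis by blast
qed

lemma sumset_subset_closed:
  assumes "0 \<in> K" "\<And>u v. u \<in> K \<Longrightarrow> v \<in> K \<Longrightarrow> u + v \<in> K" "set_mset B \<subseteq> K"
  shows "sumset B \<subseteq> K"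
proof -
  have "\<Sum>\<^sub># C \<in> K" if "set_mset C \<subseteq> K" for C
    using that by (induction C) (auto intro: assms)
  moreover have "set_mset C \<subseteq> K" if "C \<subseteq># B" for C
    using set_mset_mono[OF that] assms(3) by blast
  ultimately show ?thesis unfolding sumset_def by blast
qed

lemma translation_iterate_mem:
  assumes "(+) b ` T \<subseteq> T" "u \<in> T"
  shows "((+) b ^^ n) u \<in> T"
  using assms by (induction n) auto

text \<open>Cauchy-Davenport for two-element summands: when a translation acts transitively on
  \<open>K\<close>, it cannot map a nonempty proper subset of \<open>K\<close> into itself, so every new element
  contributes at least one new sum until \<open>K\<close> is exhausted.\<close>

lemma card_sumset_transitive:
  assumes "finite K" "0 \<in> K" "\<And>u v. u \<in> K \<Longrightarrow> v \<in> K \<Longrightarrow> u + v \<in> K"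
    and "set_mset B \<subseteq> K"
    and trans: "\<And>b u v. b \<in># B \<Longrightarrow> u \<in> K \<Longrightarrow> v \<in> K \<Longrightarrow> \<exists>n. v = ((+) b ^^ n) u"
  shows "min (card K) (size B + 1) \<le> card (sumset B)"
  using assms(4) trans
proof (induction B)
  case empty
  have "sumset {#} = {0 :: 'a}" by (auto simp: sumset_def)
  then show ?case by simp
next
  case (add b B)
  have IH: "min (card K) (size B + 1) \<le> card (sumset B)"
    using add by auto
  have sub: "sumset (add_mset b B) \<subseteq> K"
    by (intro sumset_subset_closed assms add)
  then have fin: "finite (sumset (add_mset b B))"
    using assms(1) finite_subset by blast
  have new: "sumset B \<union> (+) b ` sumset B \<subseteq> sumset (add_mset b B)"
    by (rule sumset_add_mset)
  show ?case
  proof (cases "sumset B = K")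
    case True
    then have "card K \<le> card (sumset (add_mset b B))"
      using new fin by (intro card_mono) auto
    then show ?thesis by simp
  next
    case False
    have "sumset B \<subset> sumset (add_mset b B)"
    proof (rule ccontr)
      assume "\<not> ?thesis"
      then have "(+) b ` sumset B \<subseteq> sumset B" using new by blast
      then have "((+) b ^^ n) 0 \<in> sumset B" for n
        using translation_iterate_mem zero_in_sumset by blast
      moreover have "\<exists>n. v = ((+) b ^^ n) 0" if "v \<in> K" for v
        using that add.prems(2)[of b 0 v] assms(2) by simp
      ultimately have "K \<subseteq> sumset B" by fastforce
      then show False using False sub new by auto
    qed
    then have "card (sumset B) < card (sumset (add_mset b B))"
      using fin psubset_card_mono by blast
    then show ?thesis using IH by simp
  qed
qed

section \<open>Lines in the plane and their cosets\<close>

text \<open>The determinant of two plane vectors. For \<open>x \<noteq> 0\<close> the map \<open>wedge x\<close> is linear with the line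
  through \<open>x\<close> as its kernel, so it serves as the quotient map onto \<open>\<int>\<^sub>p\<close> and its fibres
  are the cosets of that line.\<close>

definition wedge :: "'p :: prime_card zp2 \<Rightarrow> 'p zp2 \<Rightarrow> 'p mod_ring" where
  "wedge x v = fst x * snd v - snd x * fst v"

lemma wedge_add: "wedge x (u + v) = wedge x u + wedge x v"
  and wedge_zero [simp]: "wedge x 0 = 0"
  and wedge_self [simp]: "wedge x x = 0"
  by (simp_all add: wedge_def algebra_simps)

lemma wedge_uminus: "wedge x (- v) = - wedge x v"
  by (simp add: wedge_def)

lemma wedge_eq_iff:
  assumes "x \<noteq> 0"
  shows "wedge x u = wedge x v \<longleftrightarrow> (\<exists>c. v = u + (c * fst x, c * snd x))"
proof
  assume eq: "wedge x u = wedge x v"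
  show "\<exists>c. v = u + (c * fst x, c * snd x)"
  proof (cases "fst x = 0")
    case True
    then have "snd x \<noteq> 0" using assms by (simp add: prod_eq_iff)
    then show ?thesis using eq True
      by (intro exI[of _ "(snd v - snd u) / snd x"]) (auto simp: prod_eq_iff wedge_def)
  next
    case False
    then show ?thesis using eq
      by (intro exI[of _ "(fst v - fst u) / fst x"])
        (auto simp: prod_eq_iff wedge_def field_simps)
  qed
next
  assume "\<exists>c. v = u + (c * fst x, c * snd x)"
  then show "wedge x u = wedge x v" by (auto simp: wedge_def algebra_simps)
qed

lemma wedge_proportional:
  assumes "x \<noteq> 0" "wedge x b = 0" "wedge x u = 0"
  shows "wedge b u = 0"
proof -
  obtain c d where "b = (c * fst x, c * snd x)" "u = (d * fst x, d * snd x)"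
    using wedge_eq_iff[OF assms(1), of 0] assms(2,3) by auto
  then show ?thesis by (simp add: wedge_def)
qed

lemma translation_iterate_mod_ring:
  "((+) b ^^ n) u = u + of_nat n * (b :: 'p :: prime_card mod_ring)"
  by (induction n) (simp_all add: algebra_simps)

lemma translation_iterate_zp2:
  "((+) x ^^ n) u = u + (of_nat n * fst x, of_nat n * snd (x :: 'p :: prime_card zp2))"
  by (induction n) (simp_all add: algebra_simps prod_eq_iff)

lemma translation_transitive_coset:
  assumes "x \<noteq> 0" "wedge x u = wedge x v"
  shows "\<exists>n. v = ((+) x ^^ n) u"
  using assms wedge_eq_iff surj_of_nat_mod_ring unfolding translation_iterate_zp2 by metis

lemma card_coset:
  fixes x :: "'p :: prime_card zp2"
  assumes "x \<noteq> 0"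
  shows "card {v. wedge x v = wedge x u} = CARD('p)"
proof -
  have "{v. wedge x v = wedge x u} = range (\<lambda>c. u + (c * fst x, c * snd x))"
    using wedge_eq_iff[OF assms, of u] by force
  moreover have "inj (\<lambda>c. u + (c * fst x, c * snd x))"
    using assms by (auto simp: inj_on_def prod_eq_iff)
  ultimately show ?thesis by (simp add: card_image)
qed

lemma wedge_inj:
  assumes "wedge x y \<noteq> 0" "wedge x u = wedge x v" "wedge y u = wedge y v"
  shows "u = v"
proof -
  have "x \<noteq> 0" using assms(1) by (auto simp: wedge_def)
  then obtain c where c: "v = u + (c * fst x, c * snd x)"
    using assms(2) wedge_eq_iff by blast
  have "c * wedge x y = 0"
    using assms(3) c by (auto simp: wedge_def algebra_simps)
  then show ?thesis using c assms(1) by (simp add: prod_eq_iff)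
qed

text \<open>For independent \<open>x\<close> and \<open>y\<close> the two cosets of a point are its coordinates, so \<open>S\<close> lies in
  the product of its two coordinate projections.\<close>

lemma card_le_cosets_times_cosets:
  fixes S :: "'p :: prime_card zp2 set"
  assumes "wedge x y \<noteq> 0"
  shows "card S \<le> card (wedge x ` S) * card (wedge y ` S)"
proof -
  have "inj_on (\<lambda>v. (wedge x v, wedge y v)) S"
    using wedge_inj[OF assms] by (auto simp: inj_on_def)
  then have "card S = card ((\<lambda>v. (wedge x v, wedge y v)) ` S)"
    by (simp add: card_image)
  also have "\<dots> \<le> card (wedge x ` S \<times> wedge y ` S)"
    by (intro card_mono) auto
  finally show ?thesis by (simp add: card_cartesian_product)
qed

text \<open>Each coset of the line through \<open>x\<close> that meets \<open>S\<close> without lying inside \<open>S\<close> contributes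
  a new point to the translate of \<open>S\<close> by \<open>x\<close>; the cosets that lie inside \<open>S\<close> are at most
  \<open>card S\<close> divided by the prime in number.\<close>

lemma new_points_of_translate:
  fixes S :: "'p :: prime_card zp2 set"
  assumes x: "x \<noteq> 0"
  shows "card (wedge x ` S) * CARD('p) \<le> card ((+) x ` S - S) * CARD('p) + card S"
proof -
  define F where "F = {t \<in> wedge x ` S. {v. wedge x v = t} \<subseteq> S}"
  have "wedge x ` S - F \<subseteq> wedge x ` ((+) x ` S - S)"
  proof
    fix t assume t: "t \<in> wedge x ` S - F"
    then obtain u v where u: "u \<in> S" "wedge x u = t" and v: "v \<notin> S" "wedge x v = t"
      unfolding F_def by auto
    let ?T = "{w \<in> S. wedge x w = t}"
    have "\<not> (+) x ` ?T \<subseteq> ?T"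
    proof
      assume "(+) x ` ?T \<subseteq> ?T"
      then have "((+) x ^^ n) u \<in> ?T" for n
        using u by (intro translation_iterate_mem) auto
      moreover obtain n where "v = ((+) x ^^ n) u"
        using translation_transitive_coset[OF x] u v by metis
      ultimately show False using v by auto
    qed
    then obtain w where "w \<in> ?T" "x + w \<notin> ?T" by blast
    then have "x + w \<in> (+) x ` S - S" "wedge x (x + w) = t"
      by (auto simp: wedge_add)
    then show "t \<in> wedge x ` ((+) x ` S - S)" by blast
  qed
  then have "card (wedge x ` S - F) \<le> card ((+) x ` S - S)"
    by (meson finite card_image_le card_mono order_trans)
  moreover have "card (wedge x ` S) \<le> card (wedge x ` S - F) + card F"
    using diff_card_le_card_Diff[of F "wedge x ` S"] by simp
  moreover have "card F * CARD('p) \<le> card S"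
  proof -
    have "card (\<Union>t\<in>F. {v. wedge x v = t}) = (\<Sum>t\<in>F. card {v. wedge x v = t})"
      by (intro card_UN_disjoint) auto
    also have "\<dots> = (\<Sum>t\<in>F. CARD('p))"
      by (intro sum.cong refl) (auto simp: F_def card_coset[OF x])
    finally have "card F * CARD('p) = card (\<Union>t\<in>F. {v. wedge x v = t})" by simp
    also have "\<dots> \<le> card S"
      by (intro card_mono) (auto simp: F_def)
    finally show ?thesis .
  qed
  ultimately have N: "card (wedge x ` S) \<le> card ((+) x ` S - S) + card F"
    and full: "card F * CARD('p) \<le> card S" by linarith+
  show ?thesis
    using mult_le_mono1[OF N, of "CARD('p)"] full unfolding add_mult_distrib by linarith
qed

section \<open>A line containing many points\<close>

text \<open>Sums of elements off the line represent many cosets of it; adding to each representative the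
  sums of elements on the line fills each of these cosets equally.\<close>

lemma card_sumset_via_line:
  fixes A :: "'p :: prime_card zp2 multiset"
  assumes x: "x \<noteq> 0" and A: "0 \<notin># A"
  defines "h \<equiv> size {#v \<in># A. wedge x v = 0#}"
  shows "min CARD('p) (h + 1) * min CARD('p) (size A - h + 1) \<le> card (sumset A)"
proof -
  define B C where "B = {#v \<in># A. wedge x v = 0#}" and "C = {#v \<in># A. wedge x v \<noteq> 0#}"
  define K where "K = {v. wedge x v = 0}"
  have ABC: "A = B + C" unfolding B_def C_def by (rule multiset_partition)
  have "size A = size B + size C" by (simp add: ABC)
  then have sizes: "size B = h" "size C = size A - h"
    by (simp_all add: h_def B_def)
  have cardK: "card K = CARD('p)"
    using card_coset[OF x, of 0] by (simp add: K_def)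
  have BK: "sumset B \<subseteq> K"
    by (rule sumset_subset_closed) (auto simp: K_def B_def wedge_add)
  have 1: "min CARD('p) (h + 1) \<le> card (sumset B)"
    unfolding cardK[symmetric] sizes(1)[symmetric]
  proof (rule card_sumset_transitive)
    fix b u v assume b: "b \<in># B" and uv: "u \<in> K" "v \<in> K"
    from b have bx: "b \<noteq> 0" "wedge x b = 0" using A by (auto simp: B_def)
    then have "wedge b u = 0" "wedge b v = 0"
      using wedge_proportional[OF x] uv by (auto simp: K_def)
    then show "\<exists>n. v = ((+) b ^^ n) u"
      using translation_transitive_coset[OF bx(1)] by metis
  qed (auto simp: K_def B_def wedge_add)
  have "min (card (UNIV :: 'p mod_ring set)) (size (image_mset (wedge x) C) + 1)
      \<le> card (sumset (image_mset (wedge x) C))"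
  proof (rule card_sumset_transitive)
    fix b u v assume "b \<in># image_mset (wedge x) C"
    then have "b \<noteq> 0" by (auto simp: C_def)
    then have "v = u + (v - u) / b * b" by simp
    then show "\<exists>n. v = ((+) b ^^ n) u"
      unfolding translation_iterate_mod_ring by (metis surj_of_nat_mod_ring)
  qed auto
  also have "\<dots> \<le> card (wedge x ` sumset C)"
    by (intro card_mono sumset_image_additive) (auto simp: wedge_add)
  finally have 2: "min CARD('p) (size A - h + 1) \<le> card (wedge x ` sumset C)"
    by (simp add: sizes)
  \<comment> \<open>\<open>r t\<close> is a sum of elements of \<open>C\<close> that represents the coset \<open>t\<close>.\<close>
  define r where "r = inv_into (sumset C) (wedge x)"
  have r: "r t \<in> sumset C" "wedge x (r t) = t" if "t \<in> wedge x ` sumset C" for t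
    using that by (auto simp: r_def inv_into_into f_inv_into_f)
  have "inj_on (\<lambda>(s, t). s + r t) (sumset B \<times> wedge x ` sumset C)"
  proof (rule inj_onI, clarify)
    fix s t s' t'
    assume *: "s \<in> sumset B" "t \<in> sumset C" "s' \<in> sumset B" "t' \<in> sumset C"
      "s + r (wedge x t) = s' + r (wedge x t')"
    then have "wedge x s = 0" "wedge x s' = 0" using BK by (auto simp: K_def)
    moreover have "wedge x (s + r (wedge x t)) = wedge x (s' + r (wedge x t'))"
      by (simp only: *(5))
    ultimately have "wedge x t = wedge x t'"
      using *(2,4) by (simp add: wedge_add r(2))
    then show "s = s' \<and> wedge x t = wedge x t'" using * by simp
  qed
  then have "card (sumset B) * card (wedge x ` sumset C)
      = card ((\<lambda>(s, t). s + r t) ` (sumset B \<times> wedge x ` sumset C))"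
    by (simp add: card_image card_cartesian_product)
  also have "\<dots> \<le> card (sumset A)"
    using r by (intro card_mono) (auto simp: ABC intro!: sumset_union)
  finally show ?thesis
    using mult_le_mono[OF 1 2] by linarith
qed

lemma valid_line_size:
  fixes A :: "'p :: prime_card zp2 multiset"
  assumes "valid A" "x \<noteq> 0"
  shows "size {#v \<in># A. wedge x v = 0#} < CARD('p)"
proof -
  have "add_subgroup {v. wedge x v = 0}"
    by (auto simp: add_subgroup_def wedge_add wedge_uminus)
  moreover have "card {v. wedge x v = 0} = CARD('p)"
    using card_coset[OF assms(2), of 0] by simp
  ultimately show ?thesis using assms(1) unfolding valid_def by force
qed

section \<open>No line containing many points\<close>

text \<open>One of the two directions meets at least \<open>sqrt (card S)\<close> cosets. The hypothesis on \<open>card S\<close>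
  says \<open>sqrt (card S) \<le> p / 3\<close>, so the at most \<open>card S / p\<close> cosets lying inside \<open>S\<close> cost no more
  than a third of them.\<close>

lemma sqrt_growth_step:
  fixes S :: "'p :: prime_card zp2 set"
  assumes xy: "wedge x y \<noteq> 0" and S: "9 * card S \<le> CARD('p) ^ 2"
  obtains z where "z \<in> {x, y}"
    "real (card S) + 2 / 3 * sqrt (card S) \<le> card (S \<union> (+) z ` S)"
proof -
  let ?s = "real (card S)" and ?p = "real CARD('p)"
  have p: "?p > 0" by simp
  have "\<exists>z\<in>{x, y}. sqrt ?s \<le> real (card (wedge z ` S))"
  proof (rule ccontr)
    assume "\<not> ?thesis"
    then have "real (card (wedge x ` S)) * real (card (wedge y ` S)) < sqrt ?s * sqrt ?s"
      by (intro mult_strict_mono') auto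
    then show False
      using card_le_cosets_times_cosets[OF xy, of S]
      by (metis abs_of_nat not_less of_nat_le_iff of_nat_mult real_sqrt_mult_self)
  qed
  then obtain z where z: "z \<in> {x, y}" and N: "sqrt ?s \<le> real (card (wedge z ` S))" by blast
  have "z \<noteq> 0" using z xy by (auto simp: wedge_def)
  from new_points_of_translate[OF this, of S]
  have "real (card (wedge z ` S)) * ?p \<le> real (card ((+) z ` S - S)) * ?p + ?s"
    by (metis of_nat_add of_nat_le_iff of_nat_mult)
  moreover have "sqrt ?s * ?p \<le> real (card (wedge z ` S)) * ?p"
    using N p by (intro mult_right_mono) auto
  moreover have "?s \<le> 1 / 3 * sqrt ?s * ?p"
  proof -
    have "3 * sqrt ?s = sqrt (real (9 * card S))" by (simp add: real_sqrt_mult)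
    also have "\<dots> \<le> sqrt (real (CARD('p) ^ 2))"
      using S of_nat_mono real_sqrt_le_mono by blast
    finally have "3 * sqrt ?s \<le> ?p" by simp
    then have "sqrt ?s * (3 * sqrt ?s) \<le> sqrt ?s * ?p"
      by (intro mult_left_mono) auto
    moreover have "sqrt ?s * (3 * sqrt ?s) = 3 * ?s" by simp
    ultimately show ?thesis by linarith
  qed
  ultimately have "2 / 3 * sqrt ?s * ?p \<le> real (card ((+) z ` S - S)) * ?p"
    by linarith
  then have "2 / 3 * sqrt ?s \<le> real (card ((+) z ` S - S))"
    using p by (simp only: mult_le_cancel_right_pos)
  moreover have "card (S \<union> (+) z ` S) = card S + card ((+) z ` S - S)"
    by (subst card_Un_disjoint[symmetric]) auto
  ultimately show ?thesis using z that by simp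
qed

text \<open>The recursion \<open>s + 2/3 * sqrt s\<close> dominates the squares of the arithmetic progression
  \<open>1 + j/4\<close>, because \<open>(a + 1/4)^2 = a^2 + a/2 + 1/16\<close> is at most \<open>a^2 + 2/3 * a\<close> for \<open>a \<ge> 1\<close>.
  The bound \<open>k\<close> on the lines guarantees two independent elements as long as more than \<open>k\<close>
  elements remain.\<close>

lemma quadratic_growth:
  fixes A :: "'p :: prime_card zp2 multiset"
  assumes A: "0 \<notin># A" and lines: "\<And>x. x \<noteq> 0 \<Longrightarrow> size {#v \<in># A. wedge x v = 0#} \<le> k"
    and T: "9 * T \<le> CARD('p) ^ 2"
    and j: "j + k \<le> size A"
  shows "\<exists>B. B \<subseteq># A \<and> size B = j \<and>
    (T \<le> card (sumset B) \<or> (1 + real j / 4) ^ 2 \<le> card (sumset B))"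
  using j
proof (induction j)
  case 0
  have "sumset {#} = {0 :: 'p zp2}" by (auto simp: sumset_def)
  then show ?case by (intro exI[of _ "{#}"]) simp
next
  case (Suc j)
  then obtain B where B: "B \<subseteq># A" "size B = j"
    "T \<le> card (sumset B) \<or> (1 + real j / 4) ^ 2 \<le> card (sumset B)" by auto
  have size: "size (A - B) \<ge> Suc k" using Suc.prems B by (simp add: size_Diff_submset)
  then obtain x where x: "x \<in># A - B" by (cases "A - B = {#}") auto
  have x0: "x \<noteq> 0" using A x by (metis in_diffD)
  obtain y where y: "y \<in># A - B" "wedge x y \<noteq> 0"
  proof (rule ccontr)
    assume "\<not> thesis"
    then have "\<And>y. y \<in># A - B \<Longrightarrow> wedge x y = 0" using that by blast
    then have "{#v \<in># A - B. wedge x v = 0#} = A - B"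
      using filter_mset_cong[of "A - B" "A - B" "\<lambda>v. wedge x v = 0" "\<lambda>_. True"] by simp
    moreover have "{#v \<in># A - B. wedge x v = 0#} \<subseteq># {#v \<in># A. wedge x v = 0#}"
      by (intro multiset_filter_mono) simp
    ultimately have "size (A - B) \<le> k"
      using lines[OF x0] size_mset_mono[of "A - B" "{#v \<in># A. wedge x v = 0#}"] by simp
    then show False using size by simp
  qed
  have ext: "add_mset z B \<subseteq># A" if "z \<in> {x, y}" for z
  proof -
    have "{#z#} \<subseteq># A - B" using that x y(1) by auto
    then have "B + {#z#} \<subseteq># B + (A - B)" by (rule subset_mset.add_left_mono)
    then show ?thesis by (simp add: subset_mset.add_diff_inverse[OF B(1)])
  qed
  show ?case
  proof (cases "T \<le> card (sumset B)")
    case True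
    have "card (sumset B) \<le> card (sumset (add_mset x B))"
      using sumset_add_mset[of B x] by (intro card_mono) auto
    then show ?thesis using True B ext by (intro exI[of _ "add_mset x B"]) auto
  next
    case False
    define s where "s = real (card (sumset B))"
    have "9 * card (sumset B) \<le> CARD('p) ^ 2" using False T by simp
    then obtain z where z: "z \<in> {x, y}"
      "s + 2 / 3 * sqrt s \<le> card (sumset B \<union> (+) z ` sumset B)"
      using sqrt_growth_step[OF y(2)] unfolding s_def by metis
    define a where "a = 1 + real j / 4"
    have a: "a \<ge> 1" "a ^ 2 \<le> s" using False B by (auto simp: a_def s_def)
    then have "a \<le> sqrt s" using real_le_rsqrt by blast
    then have "a ^ 2 + 2 / 3 * a \<le> s + 2 / 3 * sqrt s" using a by linarith
    moreover have "(a + 1 / 4) ^ 2 \<le> a ^ 2 + 2 / 3 * a"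
      using a by (simp add: power2_eq_square algebra_simps)
    moreover have "card (sumset B \<union> (+) z ` sumset B) \<le> card (sumset (add_mset z B))"
      using sumset_add_mset[of B z] by (intro card_mono) auto
    ultimately have "(a + 1 / 4) ^ 2 \<le> card (sumset (add_mset z B))"
      using z by linarith
    moreover have "a + 1 / 4 = 1 + real (Suc j) / 4" by (simp add: a_def field_simps)
    ultimately show ?thesis using ext z B by (intro exI[of _ "add_mset z B"]) auto
  qed
qed

text \<open>The hypothesis on \<open>k\<close> reads \<open>(k + 1)^2 * (2 * ln p + 1) \<le> p\<close>. As \<open>k + 1 \<ge> 3\<close>, it bounds \<open>p\<close>
  from below in terms of \<open>ln p\<close>, and two rounds of this, with \<open>3^n\<close> in place of \<open>exp n\<close>, lead
  from \<open>p \<ge> 9\<close> to \<open>ln p \<ge> 2\<close>, so \<open>p \<ge> 45\<close>, and then to \<open>ln p \<ge> 3\<close>.\<close>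

lemma seven_times_square_le:
  fixes p k :: nat
  assumes p: "p > 1" and k: "2 \<le> k" "real k \<le> sqrt (real p / (2 * ln (real p) + 1)) - 1"
  shows "7 * (k + 1) ^ 2 \<le> p"
proof -
  define L where "L = 2 * ln (real p) + 1"
  have L: "L > 1" using p by (simp add: L_def)
  have "(real k + 1) ^ 2 \<le> (sqrt (real p / L)) ^ 2"
    using k by (intro power_mono) (auto simp: L_def)
  also have "\<dots> = real p / L" using L p by simp
  finally have main: "(real k + 1) ^ 2 * L \<le> real p" using L by (simp add: field_simps)
  have "(3 :: real) ^ 2 \<le> (real k + 1) ^ 2" using k by (intro power_mono) auto
  then have "3 ^ 2 * L \<le> (real k + 1) ^ 2 * L" using L by (intro mult_right_mono) auto
  then have nine: "9 * L \<le> real p" using main by simp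
  have ln_ge: "real n \<le> ln (real p)" if "(3 :: real) ^ n \<le> real p" for n
  proof -
    have "exp (real n) = exp 1 ^ n" by (simp add: exp_of_nat_mult[symmetric])
    also have "\<dots> \<le> 3 ^ n" using exp_le by (intro power_mono) auto
    finally have "exp (real n) \<le> real p" using that by linarith
    then show ?thesis using p by (simp add: ln_ge_iff)
  qed
  have "real 2 \<le> ln (real p)" using nine L by (intro ln_ge) auto
  then have "real 3 \<le> ln (real p)" using nine by (intro ln_ge) (auto simp: L_def)
  then have "(real k + 1) ^ 2 * 7 \<le> (real k + 1) ^ 2 * L"
    by (intro mult_left_mono) (auto simp: L_def)
  moreover have "real (7 * (k + 1) ^ 2) = (real k + 1) ^ 2 * 7" by (simp add: add.commute)
  ultimately have "real (7 * (k + 1) ^ 2) \<le> real p" using main by linarith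
  then show ?thesis by linarith
qed

theorem theorem1p8:
  fixes p k :: nat and A :: "'p :: prime_card zp2 multiset"
  assumes "p = CARD('p)"
    and "2 \<le> k"
    and "real k \<le> sqrt (real p / (2 * ln (real p) + 1)) - 1"
    and "valid A"
    and "size A = p + k"
  shows "card (sumset A) \<ge> (k + 2) * p"
proof -
  have A0: "0 \<notin># A" using assms(4) by (simp add: valid_def)
  show ?thesis
  proof (cases "\<exists>x. x \<noteq> 0 \<and> k < size {#v \<in># A. wedge x v = 0#}")
    case True
    then obtain x where x: "x \<noteq> 0" "k < size {#v \<in># A. wedge x v = 0#}" by blast
    define h where "h = size {#v \<in># A. wedge x v = 0#}"
    have h: "k < h" "h < p"
      using x valid_line_size[OF assms(4) x(1)] assms(1) by (auto simp: h_def)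
    \<comment> \<open>\<open>a * b\<close> is the excess \<open>(h - k - 1) * (p - 1 - h)\<close> over \<open>(k + 2) * p\<close>.\<close>
    obtain a b where ab: "h = k + 1 + a" "p = h + 1 + b"
      using h by (metis less_iff_Suc_add Suc_eq_plus1 add.assoc add.commute)
    have "min p (h + 1) * min p (size A - h + 1) \<le> card (sumset A)"
      using card_sumset_via_line[OF x(1) A0] unfolding h_def assms(1) .
    moreover have "min p (h + 1) = h + 1" "min p (size A - h + 1) = p + k - h + 1"
      using h assms(5) by auto
    moreover have "(h + 1) * (p + k - h + 1) = (k + 2) * p + a * b"
      by (simp add: ab algebra_simps)
    ultimately show ?thesis by simp
  next
    case False
    define m where "m = k + 1"
    define q where "q = m * m"
    have m: "3 \<le> m" "7 * q \<le> p"
      using seven_times_square_le[of p k] assms(1-3) prime_gt_1_nat[OF prime_card[where 'a = 'p]]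
      by (auto simp: q_def m_def power2_eq_square)
    have mm: "3 * m \<le> q" using m(1) by (simp add: q_def)
    have "9 * m + 9 \<le> p" using m mm by linarith
    then have "9 * (k + 2) \<le> p" by (simp add: m_def)
    then have "9 * ((k + 2) * p) \<le> p * p"
      using mult_le_mono1[of "9 * (k + 2)" p p] by (simp only: mult.assoc)
    then obtain B where B: "B \<subseteq># A"
      "(k + 2) * p \<le> card (sumset B) \<or> (1 + real p / 4) ^ 2 \<le> card (sumset B)"
      using quadratic_growth[OF A0, of k "(k + 2) * p" p] False assms(1,5)
      by (force simp: power2_eq_square not_less)
    \<comment> \<open>Equivalent to \<open>(k + 2) * p \<le> p^2 / 16 + p / 2\<close>, and \<open>p^2 / 16 + p / 2 + 1\<close> is the square
      reached after \<open>p\<close> steps.\<close>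
    have "16 * m + 16 \<le> p + 8" using m mm by linarith
    then have "(16 * m + 16) * p \<le> (p + 8) * p" by (rule mult_le_mono1)
    then have "real ((16 * m + 16) * p) \<le> real ((p + 8) * p)" by (rule of_nat_mono)
    then have "real ((k + 2) * p) \<le> (1 + real p / 4) ^ 2"
      by (simp add: m_def power2_eq_square algebra_simps)
    then have "(k + 2) * p \<le> card (sumset B)" using B(2) by linarith
    also have "\<dots> \<le> card (sumset A)"
      using sumset_mono[OF B(1)] by (intro card_mono) auto
    finally show ?thesis .
  qed
qed

end
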